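(* Let $L$ be a $4$-dimensional solvable right Leibniz algebra over $\mathbb C$ whose nilradical is isomorphic to the $3$-dimensional Leibniz algebra $\mu_1$ with basis $\{x,y,z\}$ and only non-zero bracket of basis elements $[x,x]=z$. Then $L$ is dextral symmetric if and only if it is isomorphic to one of the following three pairwise non-isomorphic algebras, each with basis $\{x,y,z,w\}$ (only non-zero brackets of basis elements listed): $$\mathscr R_3(\beta):\ [y,y]=w,\ [z,x]=z,\ [x,y]=w,\ [x,x]=\beta w,\quad \beta\in\mathbb C;$$ $$\mathscr R_4:\ [y,y]=w,\ [z,x]=z;$$ $$\mathscr R_5:\ [y,y]=w,\ [z,x]=z,\ [x,y]=w,\ [y,x]=w.$$
   Context: A right Leibniz algebra over a field $F$ is an $F$-vector space $L$ with a bilinear bracket $[\,,]:L\times L\to L$ satisfying $[a,[b,c]]=[[a,b],c]-[[a,c],b]$ for all $a,b,c\in L$. $L$ is solvable if $L^{[k]}=0$ for some $k\in\mathbb N$, where $L^{[1]}=L$, $L^{[n+1]}=[L^{[n]},L^{[n]}]$ (span of brackets). A Leibniz algebra $N$ is nilpotent (equivalently, right nilpotent) if $N^{<k>}=0$ for some $k$, where $N^{<1>}=N$, $N^{<n+1>}=[N^{<n>},N]$. The nilradical of $L$ is its maximal nilpotent (two-sided) ideal. $L$ is dextral symmetric if for all $a,b,c\in L$, $[a,[b,c]]=0$ implies $[b,[a,c]]=0$. *)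

theory Defs
  imports "HOL-Analysis.Analysis"
begin

locale right_leibniz_algebra = vector_space scale
  for scale :: "'f::field \<Rightarrow> 'a::ab_group_add \<Rightarrow> 'a" +
  fixes bracket :: "'a \<Rightarrow> 'a \<Rightarrow> 'a"
  assumes bracket_add_left: "bracket (a + b) c = bracket a c + bracket b c"
    and bracket_add_right: "bracket a (b + c) = bracket a b + bracket a c"
    and bracket_scale_left: "bracket (scale r a) b = scale r (bracket a b)"
    and bracket_scale_right: "bracket a (scale r b) = scale r (bracket a b)"
    and leibniz: "bracket a (bracket b c) = bracket (bracket a b) c - bracket (bracket a c) b"
begin

definition bracket_span :: "'a set \<Rightarrow> 'a set \<Rightarrow> 'a set"
  where "bracket_span A B = span {bracket a b |a b. a \<in> A \<and> b \<in> B}"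

text \<open>Both series are usually indexed from 1; here they start at index 0, so
  \<open>derived_series k\<close> is $L^{[k+1]}$ and \<open>lower_central_series N k\<close> is $N^{<k+1>}$.\<close>

primrec derived_series :: "nat \<Rightarrow> 'a set" where
  "derived_series 0 = UNIV"
| "derived_series (Suc k) = bracket_span (derived_series k) (derived_series k)"

definition solvable :: bool
  where "solvable \<longleftrightarrow> (\<exists>k. derived_series k = {0})"

primrec lower_central_series :: "'a set \<Rightarrow> nat \<Rightarrow> 'a set" where
  "lower_central_series N 0 = N"
| "lower_central_series N (Suc k) = bracket_span (lower_central_series N k) N"

definition nilpotent :: "'a set \<Rightarrow> bool"
  where "nilpotent N \<longleftrightarrow> (\<exists>k. lower_central_series N k = {0})"

definition two_sided_ideal :: "'a set \<Rightarrow> bool"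
  where "two_sided_ideal I \<longleftrightarrow>
    subspace I \<and> (\<forall>a\<in>I. \<forall>b. bracket a b \<in> I \<and> bracket b a \<in> I)"

text \<open>In finite dimension a sum of two nilpotent ideals is again a nilpotent ideal, so a maximal
  one is unique and contains all the others.\<close>

definition is_nilradical :: "'a set \<Rightarrow> bool"
  where "is_nilradical N \<longleftrightarrow> two_sided_ideal N \<and> nilpotent N \<and>
    (\<forall>I. two_sided_ideal I \<and> nilpotent I \<and> N \<subseteq> I \<longrightarrow> I = N)"

definition dextral_symmetric :: bool
  where "dextral_symmetric \<longleftrightarrow>
    (\<forall>a b c. bracket a (bracket b c) = 0 \<longrightarrow> bracket b (bracket a c) = 0)"

end

text \<open>Isomorphism of algebras \<open>(V\<^sub>1, s\<^sub>1, br\<^sub>1)\<close> and \<open>(V\<^sub>2, s\<^sub>2, br\<^sub>2)\<close> with explicit carriers, so that it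
  also applies to subalgebras, such as the nilradical.\<close>

definition algebra_isomorphic ::
  "('f \<Rightarrow> 'a::ab_group_add \<Rightarrow> 'a) \<Rightarrow> ('a \<Rightarrow> 'a \<Rightarrow> 'a) \<Rightarrow> 'a set \<Rightarrow>
   ('f \<Rightarrow> 'b::ab_group_add \<Rightarrow> 'b) \<Rightarrow> ('b \<Rightarrow> 'b \<Rightarrow> 'b) \<Rightarrow> 'b set \<Rightarrow> bool"
  where "algebra_isomorphic s\<^sub>1 br\<^sub>1 V\<^sub>1 s\<^sub>2 br\<^sub>2 V\<^sub>2 \<longleftrightarrow>
    (\<exists>f. bij_betw f V\<^sub>1 V\<^sub>2 \<and>
      (\<forall>a\<in>V\<^sub>1. \<forall>b\<in>V\<^sub>1. f (a + b) = f a + f b) \<and>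
      (\<forall>r. \<forall>a\<in>V\<^sub>1. f (s\<^sub>1 r a) = s\<^sub>2 r (f a)) \<and>
      (\<forall>a\<in>V\<^sub>1. \<forall>b\<in>V\<^sub>1. f (br\<^sub>1 a b) = br\<^sub>2 (f a) (f b)))"

text \<open>The bilinear bracket on the coordinate space with prescribed values \<open>T i j\<close> on pairs of
  standard basis vectors.\<close>

definition table_bracket ::
  "('n::finite \<Rightarrow> 'n \<Rightarrow> complex ^ 'n) \<Rightarrow> complex ^ 'n \<Rightarrow> complex ^ 'n \<Rightarrow> complex ^ 'n"
  where "table_bracket T a b = (\<Sum>i\<in>UNIV. \<Sum>j\<in>UNIV. (a $ i * b $ j) *s T i j)"

text \<open>The basis vectors $x, y, z$ (and $w$) are \<open>axis 1 1\<close>, \<open>axis 2 1\<close>, \<open>axis 3 1\<close> (and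
  \<open>axis 4 1\<close>). In the index types \<open>3\<close> and \<open>4\<close> the last index also reads \<open>0\<close>.\<close>

definition mu1 :: "complex ^ 3 \<Rightarrow> complex ^ 3 \<Rightarrow> complex ^ 3"
  where "mu1 = table_bracket (\<lambda>i j. if (i, j) = (1, 1) then axis 3 1 else 0)"

definition R3 :: "complex \<Rightarrow> complex ^ 4 \<Rightarrow> complex ^ 4 \<Rightarrow> complex ^ 4"
  where "R3 \<beta> = table_bracket (\<lambda>i j.
    if (i, j) = (2, 2) then axis 4 1
    else if (i, j) = (3, 1) then axis 3 1
    else if (i, j) = (1, 2) then axis 4 1
    else if (i, j) = (1, 1) then \<beta> *s axis 4 1
    else 0)"

definition R4 :: "complex ^ 4 \<Rightarrow> complex ^ 4 \<Rightarrow> complex ^ 4"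
  where "R4 = table_bracket (\<lambda>i j.
    if (i, j) = (2, 2) then axis 4 1
    else if (i, j) = (3, 1) then axis 3 1
    else 0)"

definition R5 :: "complex ^ 4 \<Rightarrow> complex ^ 4 \<Rightarrow> complex ^ 4"
  where "R5 = table_bracket (\<lambda>i j.
    if (i, j) = (2, 2) then axis 4 1
    else if (i, j) = (3, 1) then axis 3 1
    else if (i, j) = (1, 2) then axis 4 1
    else if (i, j) = (2, 1) then axis 4 1
    else 0)"

lemmas table_simps = table_bracket_def vec_eq_iff forall_3 forall_4 sum_3 sum_4 axis_def algebra_simps

lemma right_leibniz_algebra_mu1: "right_leibniz_algebra (*s) mu1"
  by unfold_locales (simp_all add: mu1_def table_simps)

lemma right_leibniz_algebra_R3: "right_leibniz_algebra (*s) (R3 \<beta>)"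
  by unfold_locales (simp_all add: R3_def table_simps)

lemma right_leibniz_algebra_R4: "right_leibniz_algebra (*s) R4"
  by unfold_locales (simp_all add: R4_def table_simps)

lemma right_leibniz_algebra_R5: "right_leibniz_algebra (*s) R5"
  by unfold_locales (simp_all add: R5_def table_simps)

end

theory Submission imports Defs begin

text \<open>In a right Leibniz algebra \<open>[a, [b, b]] = 0\<close>, so dextral symmetry gives \<open>[b, [a, b]] = 0\<close> and
  \<open>[a, [b, c]]\<close> is alternating. Write \<open>L\<close> as the sum of the nilradical \<open>N\<close>, with basis \<open>n, m, c\<close>
  and \<open>[n, n] = c\<close>, and the line through some \<open>e\<close>. Since \<open>[n, [e, n]]\<close> and \<open>[n, [n, e]]\<close> vanish,
  every bracket lies in the span of \<open>m\<close> and \<open>c\<close>. Let \<open>\<beta>\<close> be the coefficient of \<open>m\<close> in \<open>[m, e]\<close>.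
  If \<open>\<beta> = 0\<close>, then \<open>L\<close> is nilpotent, against the maximality of \<open>N\<close>. Otherwise \<open>[e, [m, e]] = 0\<close>
  gives \<open>[e, m] = 0\<close>, and absorbing multiples of \<open>m\<close> and \<open>c\<close> into the basis leaves \<open>[z, x] = z\<close> and
  a bilinear form with values in the line of \<open>w\<close> on the span of \<open>x\<close> and \<open>y\<close>, with \<open>[y, y] = w\<close>.
  The substitutions \<open>x \<mapsto> x + t y\<close>, \<open>y \<mapsto> s y\<close>, \<open>w \<mapsto> s\<^sup>2 w\<close> bring this form to one of the listed
  normal forms, which differ in its antisymmetric part or its discriminant.\<close>

section \<open>Algebra isomorphisms and what they preserve\<close>

lemma vector_4 [simp]:
  "(vector [a, b, c, d] :: 'a::zero ^ 4) $ 1 = a"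
  "(vector [a, b, c, d] :: 'a::zero ^ 4) $ 2 = b"
  "(vector [a, b, c, d] :: 'a::zero ^ 4) $ 3 = c"
  "(vector [a, b, c, d] :: 'a::zero ^ 4) $ 4 = d"
  unfolding vector_def by simp_all

text \<open>The closure hypotheses keep sums, multiples and brackets of preimages in
  \<open>V\<^sub>1\<close>, where the inverse map undoes \<open>f\<close>.\<close>

lemma algebra_isomorphic_sym:
  assumes "algebra_isomorphic s\<^sub>1 b\<^sub>1 V\<^sub>1 s\<^sub>2 b\<^sub>2 V\<^sub>2"
    and "\<And>u v. u \<in> V\<^sub>1 \<Longrightarrow> v \<in> V\<^sub>1 \<Longrightarrow> u + v \<in> V\<^sub>1"
    and "\<And>r u. u \<in> V\<^sub>1 \<Longrightarrow> s\<^sub>1 r u \<in> V\<^sub>1"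
    and "\<And>u v. u \<in> V\<^sub>1 \<Longrightarrow> v \<in> V\<^sub>1 \<Longrightarrow> b\<^sub>1 u v \<in> V\<^sub>1"
  shows "algebra_isomorphic s\<^sub>2 b\<^sub>2 V\<^sub>2 s\<^sub>1 b\<^sub>1 V\<^sub>1"
proof -
  obtain f where f: "bij_betw f V\<^sub>1 V\<^sub>2"
      "\<forall>a\<in>V\<^sub>1. \<forall>b\<in>V\<^sub>1. f (a + b) = f a + f b"
      "\<forall>r. \<forall>a\<in>V\<^sub>1. f (s\<^sub>1 r a) = s\<^sub>2 r (f a)"
      "\<forall>a\<in>V\<^sub>1. \<forall>b\<in>V\<^sub>1. f (b\<^sub>1 a b) = b\<^sub>2 (f a) (f b)"
    using assms(1) unfolding algebra_isomorphic_def by blast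
  define g where "g = inv_into V\<^sub>1 f"
  have g: "g u \<in> V\<^sub>1" "f (g u) = u" if "u \<in> V\<^sub>2" for u
    using f(1) that bij_betw_inv_into_right[OF f(1)] bij_betwE[OF bij_betw_inv_into[OF f(1)]]
    by (auto simp: g_def)
  have gf: "g (f u) = u" if "u \<in> V\<^sub>1" for u
    using bij_betw_inv_into_left[OF f(1) that] by (simp add: g_def)
  have "g (a + b) = g a + g b" "g (b\<^sub>2 a b) = b\<^sub>1 (g a) (g b)" if "a \<in> V\<^sub>2" "b \<in> V\<^sub>2" for a b
    using gf[of "g a + g b"] gf[of "b\<^sub>1 (g a) (g b)"] that f g assms(2,4) by simp_all
  moreover have "g (s\<^sub>2 r a) = s\<^sub>1 r (g a)" if "a \<in> V\<^sub>2" for r a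
    using gf[of "s\<^sub>1 r (g a)"] that f g assms(3) by simp
  ultimately show ?thesis
    unfolding algebra_isomorphic_def using bij_betw_inv_into[OF f(1)] g_def by blast
qed

lemma algebra_isomorphic_trans:
  assumes "algebra_isomorphic s\<^sub>1 b\<^sub>1 V\<^sub>1 s\<^sub>2 b\<^sub>2 V\<^sub>2" "algebra_isomorphic s\<^sub>2 b\<^sub>2 V\<^sub>2 s\<^sub>3 b\<^sub>3 V\<^sub>3"
  shows "algebra_isomorphic s\<^sub>1 b\<^sub>1 V\<^sub>1 s\<^sub>3 b\<^sub>3 V\<^sub>3"
proof -
  obtain f where f: "bij_betw f V\<^sub>1 V\<^sub>2"
      "\<forall>a\<in>V\<^sub>1. \<forall>b\<in>V\<^sub>1. f (a + b) = f a + f b"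
      "\<forall>r. \<forall>a\<in>V\<^sub>1. f (s\<^sub>1 r a) = s\<^sub>2 r (f a)"
      "\<forall>a\<in>V\<^sub>1. \<forall>b\<in>V\<^sub>1. f (b\<^sub>1 a b) = b\<^sub>2 (f a) (f b)"
    using assms(1) unfolding algebra_isomorphic_def by blast
  obtain g where g: "bij_betw g V\<^sub>2 V\<^sub>3"
      "\<forall>a\<in>V\<^sub>2. \<forall>b\<in>V\<^sub>2. g (a + b) = g a + g b"
      "\<forall>r. \<forall>a\<in>V\<^sub>2. g (s\<^sub>2 r a) = s\<^sub>3 r (g a)"
      "\<forall>a\<in>V\<^sub>2. \<forall>b\<in>V\<^sub>2. g (b\<^sub>2 a b) = b\<^sub>3 (g a) (g b)"
    using assms(2) unfolding algebra_isomorphic_def by blast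
  have "f a \<in> V\<^sub>2" if "a \<in> V\<^sub>1" for a
    using f(1) that bij_betwE by blast
  then show ?thesis
    unfolding algebra_isomorphic_def
    using bij_betw_trans[OF f(1) g(1)] f g by (intro exI[of _ "g \<circ> f"]) simp
qed

lemma dextral_symmetric_transfer:
  assumes "right_leibniz_algebra s\<^sub>1 b\<^sub>1" "right_leibniz_algebra s\<^sub>2 b\<^sub>2"
    and "algebra_isomorphic s\<^sub>1 b\<^sub>1 UNIV s\<^sub>2 b\<^sub>2 UNIV"
    and "right_leibniz_algebra.dextral_symmetric b\<^sub>2"
  shows "right_leibniz_algebra.dextral_symmetric b\<^sub>1"
proof -
  obtain f where f: "bij f" "\<And>a b. f (a + b) = f a + f b" "\<And>a b. f (b\<^sub>1 a b) = b\<^sub>2 (f a) (f b)"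
    using assms(3) unfolding algebra_isomorphic_def by blast
  have f0: "f u = 0 \<longleftrightarrow> u = 0" for u
    using f(2)[of 0 0] bij_is_inj[OF f(1)] by (metis add_cancel_right_right injD)
  show ?thesis
    unfolding right_leibniz_algebra.dextral_symmetric_def[OF assms(1)]
    using assms(4) unfolding right_leibniz_algebra.dextral_symmetric_def[OF assms(2)]
    by (metis f0 f(3))
qed

section \<open>A family containing the three normal forms\<close>

text \<open>The brackets \<open>[y, y] = w\<close>, \<open>[z, x] = z\<close>, \<open>[x, y] = p w\<close>, \<open>[y, x] = r w\<close>, \<open>[x, x] = q w\<close>.\<close>

definition Rfam :: "complex \<Rightarrow> complex \<Rightarrow> complex \<Rightarrow> complex ^ 4 \<Rightarrow> complex ^ 4 \<Rightarrow> complex ^ 4"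
  where "Rfam p r q a b =
    vector [0, 0, a$3 * b$1, a$2 * b$2 + p * a$1 * b$2 + r * a$2 * b$1 + q * a$1 * b$1]"

lemma vector_eq_iff_4: "u = v \<longleftrightarrow> u$1 = v$1 \<and> u$2 = v$2 \<and> u$3 = v$3 \<and> u$4 = v$4"
  for u v :: "'a ^ 4"
  by (simp add: vec_eq_iff forall_4)

lemma R3_eq_Rfam: "R3 \<beta> = Rfam 1 0 \<beta>"
  and R4_eq_Rfam: "R4 = Rfam 0 0 0"
  and R5_eq_Rfam: "R5 = Rfam 1 1 0"
  by (auto simp: fun_eq_iff R3_def R4_def R5_def Rfam_def table_simps)

lemma right_leibniz_algebra_Rfam: "right_leibniz_algebra (*s) (Rfam p r q)"
  by unfold_locales (simp_all add: Rfam_def vector_eq_iff_4 algebra_simps)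

text \<open>Brackets have zero first two coordinates, and right multiplication by such a vector
  vanishes, so \<open>[a, [b, c]]\<close> is always 0.\<close>

lemma dextral_symmetric_Rfam: "right_leibniz_algebra.dextral_symmetric (Rfam p r q)"
  unfolding right_leibniz_algebra.dextral_symmetric_def[OF right_leibniz_algebra_Rfam]
  by (simp add: Rfam_def vector_eq_iff_4)

text \<open>The map \<open>f\<close> of the proof passes to coordinates in the basis
  \<open>x + t y\<close>, \<open>s y\<close>, \<open>z\<close>, \<open>s\<^sup>2 w\<close>, whose
  brackets give the new parameters.\<close>

lemma Rfam_isomorphic_Rfam:
  assumes "s \<noteq> 0"
  shows "algebra_isomorphic (*s) (Rfam p r q) UNIV
    (*s) (Rfam ((p + t) / s) ((r + t) / s) ((q + t * (p + r) + t\<^sup>2) / s\<^sup>2)) UNIV"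
proof -
  define f :: "complex ^ 4 \<Rightarrow> complex ^ 4"
    where "f = (\<lambda>a. vector [a$1, (a$2 - t * a$1) / s, a$3, a$4 / s\<^sup>2])"
  define g :: "complex ^ 4 \<Rightarrow> complex ^ 4"
    where "g = (\<lambda>a. vector [a$1, s * a$2 + t * a$1, a$3, s\<^sup>2 * a$4])"
  have "bij f"
    by (rule o_bij[of g]) (use assms in \<open>auto simp: fun_eq_iff f_def g_def vector_eq_iff_4\<close>)
  moreover have "f (a + b) = f a + f b" "f (c *s a) = c *s f a" for a b c
    by (simp_all add: f_def vector_eq_iff_4 diff_divide_distrib add_divide_distrib algebra_simps)
  moreover have "f (Rfam p r q a b) = Rfam ((p + t) / s) ((r + t) / s)
      ((q + t * (p + r) + t\<^sup>2) / s\<^sup>2) (f a) (f b)" for a b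
    using assms by (simp add: f_def Rfam_def vector_eq_iff_4 field_simps power2_eq_square)
  ultimately show ?thesis
    unfolding algebra_isomorphic_def by blast
qed

lemma Rfam_isomorphic_normal_form:
  "(\<exists>\<beta>. algebra_isomorphic (*s) (Rfam p r q) UNIV (*s) (R3 \<beta>) UNIV) \<or>
    algebra_isomorphic (*s) (Rfam p r q) UNIV (*s) R4 UNIV \<or>
    algebra_isomorphic (*s) (Rfam p r q) UNIV (*s) R5 UNIV"
proof (cases "p = r")
  case False
  \<comment> \<open>The shift \<open>t = - r\<close> clears \<open>[y, x]\<close>, and
    \<open>s = p - r\<close> turns \<open>[x, y]\<close> into \<open>w\<close>.\<close>
  then show ?thesis
    using Rfam_isomorphic_Rfam[of "p - r" p r q "- r"] by (auto simp: R3_eq_Rfam)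
next
  case True
  show ?thesis
  proof (cases "q = p\<^sup>2")
    case q: True
    \<comment> \<open>The shift \<open>t = - p\<close> clears both mixed brackets and leaves
      \<open>q - p\<^sup>2 = 0\<close> as the coefficient of \<open>[x, x]\<close>.\<close>
    then show ?thesis
      using Rfam_isomorphic_Rfam[of 1 p r q "- p"] True by (simp add: R4_eq_Rfam power2_eq_square)
  next
    case False
    \<comment> \<open>With \<open>t = s - p\<close> both mixed coefficients become 1 and that of
      \<open>[x, x]\<close> becomes \<open>(q - p\<^sup>2 + s\<^sup>2) / s\<^sup>2\<close>, which
      vanishes for a square root \<open>s\<close> of \<open>p\<^sup>2 - q\<close>.\<close>
    define s where "s = csqrt (p\<^sup>2 - q)"
    have s: "s\<^sup>2 = p\<^sup>2 - q" "s \<noteq> 0"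
      using False by (auto simp: s_def)
    have "q + (s - p) * (p + r) + (s - p)\<^sup>2 = 0"
      using s(1) True by (simp add: power2_eq_square algebra_simps)
    then show ?thesis
      using Rfam_isomorphic_Rfam[of s p r q "s - p"] True s by (simp add: R5_eq_Rfam)
  qed
qed

text \<open>An isomorphism acts on the form with values in the line of \<open>w\<close> by \<open>x \<mapsto> x + d y\<close>, \<open>y \<mapsto> s y\<close>;
  its antisymmetric part and the discriminant of its quadratic form have weights 1 and 2 in \<open>s\<close>.\<close>

lemma Rfam_isomorphic_imp:
  assumes "algebra_isomorphic (*s) (Rfam p r q) UNIV (*s) (Rfam p' r' q') UNIV"
  obtains s where "s \<noteq> 0" "p' - r' = s * (p - r)"
    "4 * q' - (p' + r')\<^sup>2 = s\<^sup>2 * (4 * q - (p + r)\<^sup>2)"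
proof -
  obtain f where f: "bij f" "\<And>a b. f (a + b) = f a + f b" "\<And>c a. f (c *s a) = c *s f a"
      "\<And>a b. f (Rfam p r q a b) = Rfam p' r' q' (f a) (f b)"
    using assms unfolding algebra_isomorphic_def by blast
  define x y z w :: "complex ^ 4"
    where "x = vector [1, 0, 0, 0]" and "y = vector [0, 1, 0, 0]"
      and "z = vector [0, 0, 1, 0]" and "w = vector [0, 0, 0, 1]"
  note defs = x_def y_def z_def w_def
  have f0: "f u = 0 \<longleftrightarrow> u = 0" for u
    using f(2)[of 0 0] bij_is_inj[OF f(1)] by (metis add_cancel_right_right injD)
  have "z \<noteq> 0" "w \<noteq> 0"
    by (simp_all add: defs vector_eq_iff_4)
  then have "f z \<noteq> 0" "f w \<noteq> 0"
    by (simp_all add: f0)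
  have br: "Rfam p r q y y = w" "Rfam p r q z x = z" "Rfam p r q z y = 0"
      "Rfam p r q x x = q *s w" "Rfam p r q x y = p *s w" "Rfam p r q y x = r *s w"
    by (simp_all add: Rfam_def defs vector_eq_iff_4)
  have eqs: "Rfam p' r' q' (f y) (f y) = f w" "Rfam p' r' q' (f z) (f x) = f z"
      "Rfam p' r' q' (f z) (f y) = 0" "Rfam p' r' q' (f x) (f x) = q *s f w"
      "Rfam p' r' q' (f x) (f y) = p *s f w" "Rfam p' r' q' (f y) (f x) = r *s f w"
    using br f0[of 0] by (simp_all flip: f(3,4))
  \<comment> \<open>\<open>f z\<close> is itself a bracket, and brackets have zero first two
    coordinates.\<close>
  have z12: "f z $ 1 = 0" "f z $ 2 = 0"
    using eqs(2) by (simp_all add: Rfam_def vector_eq_iff_4)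
  have z34: "f z $ 3 * f x $ 1 = f z $ 3" "f z $ 4 = 0" "f z $ 3 * f y $ 1 = 0"
    using eqs(2,3) z12 by (simp_all add: Rfam_def vector_eq_iff_4)
  have "f z $ 3 \<noteq> 0"
    using \<open>f z \<noteq> 0\<close> z12 z34 by (simp add: vector_eq_iff_4)
  with z34 have xy: "f x $ 1 = 1" "f y $ 1 = 0"
    by simp_all
  have w: "f w $ 1 = 0" "f w $ 2 = 0" "f w $ 3 = 0" "f w $ 4 = (f y $ 2)\<^sup>2"
    using eqs(1) xy by (auto simp: Rfam_def vector_eq_iff_4 power2_eq_square)
  define s where "s = f y $ 2"
  define d where "d = f x $ 2"
  have s: "s \<noteq> 0"
    using \<open>f w \<noteq> 0\<close> w by (auto simp: s_def vector_eq_iff_4)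
  \<comment> \<open>Modulo the span of \<open>z\<close> and \<open>w\<close>, \<open>f x\<close> is
    \<open>x + d y\<close> and \<open>f y\<close> is \<open>s y\<close>, while \<open>f w\<close> is
    \<open>s\<^sup>2 w\<close>; the equations compare coefficients of \<open>w\<close>.\<close>
  have e: "d * s + p' * s = p * (s * s)" "s * d + r' * s = r * (s * s)"
      "d * d + p' * d + r' * d + q' = q * (s * s)"
    using eqs(4-6) xy w
    by (simp_all add: Rfam_def vector_eq_iff_4 power2_eq_square s_def d_def)
  have p: "p' = p * s - d" and r: "r' = r * s - d"
    using e(1,2) s by (simp_all add: field_simps)
      (metis (no_types) distrib_left mult.commute mult.left_commute mult_left_cancel)+
  have q: "q' = q * (s * s) - d * d - p' * d - r' * d"
    using e(3) by (simp add: algebra_simps)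
  \<comment> \<open>The shift \<open>d\<close> cancels in both \<open>p' - r'\<close> and
    \<open>4 * q' - (p' + r')\<^sup>2\<close>.\<close>
  show ?thesis
    by (rule that[OF s]) (simp_all add: q p r algebra_simps power2_eq_square)
qed


section \<open>Dextral symmetry and nilpotency in a Leibniz algebra\<close>

context right_leibniz_algebra
begin

lemma bracket_zero [simp]: "bracket 0 a = 0" "bracket a 0 = 0"
  using bracket_add_left[of 0 0 a] bracket_add_right[of a 0 0] by simp_all

lemma bracket_square_right [simp]: "bracket a (bracket b b) = 0"
  by (simp add: leibniz)

lemma bracket_bracket_swap: "bracket a (bracket b c) = - bracket a (bracket c b)"
  by (simp add: leibniz)

lemma dextral_symmetric_alternating:
  assumes dextral_symmetric
  shows "bracket b (bracket a b) = 0" "bracket b (bracket b a) = 0"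
proof -
  show "bracket b (bracket a b) = 0"
    using assms bracket_square_right[of a b] unfolding dextral_symmetric_def by blast
  then show "bracket b (bracket b a) = 0"
    using bracket_bracket_swap[of b b a] by simp
qed

lemma nilpotent_UNIV:
  assumes "\<And>a b c d. bracket (bracket (bracket a b) c) d = 0"
  shows "nilpotent UNIV"
proof -
  let ?L = "lower_central_series UNIV"
  have step: "?L (Suc k) \<subseteq> S" if "\<And>a b. a \<in> ?L k \<Longrightarrow> bracket a b \<in> S" "subspace S" for k S
    unfolding lower_central_series.simps bracket_span_def
    by (rule span_minimal) (use that in auto)
  \<comment> \<open>The series is indexed from 0: elements of term \<open>k\<close> vanish after
    \<open>3 - k\<close> right multiplications. These conditions define subspaces, so generators of
    the spans suffice.\<close>
  have "?L 1 \<subseteq> {a. \<forall>c d. bracket (bracket a c) d = 0}"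
    unfolding One_nat_def using assms
    by (intro step) (auto simp: subspace_def bracket_add_left bracket_scale_left)
  then have "?L 2 \<subseteq> {a. \<forall>d. bracket a d = 0}"
    unfolding numeral_2_eq_2 One_nat_def
    by (intro step) (auto simp: subspace_def bracket_add_left bracket_scale_left)
  then have "?L 3 \<subseteq> {0}"
    unfolding numeral_3_eq_3 numeral_2_eq_2
    by (intro step) (auto simp: subspace_def)
  moreover have "0 \<in> ?L 3"
    by (simp add: numeral_3_eq_3 bracket_span_def span_zero)
  ultimately show ?thesis
    unfolding nilpotent_def by blast
qed

end

section \<open>Reduction to the family in adapted coordinates\<close>

text \<open>Coordinates 1 to 4 belong to \<open>e\<close>, \<open>n\<close>, \<open>m\<close>,
  \<open>c\<close>, and the nilradical is the hyperplane \<open>a$1 = 0\<close>. Its maximality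
  enters as \<open>non_nilpotent\<close>.\<close>

lemma algebra_isomorphic_Rfam:
  fixes br :: "complex ^ 4 \<Rightarrow> complex ^ 4 \<Rightarrow> complex ^ 4"
  assumes "right_leibniz_algebra (*s) br"
    and dext: "right_leibniz_algebra.dextral_symmetric br"
    and mu1: "\<And>a b. a$1 = 0 \<Longrightarrow> b$1 = 0 \<Longrightarrow> br a b = vector [0, 0, 0, a$2 * b$2]"
    and ideal: "\<And>a b. a$1 = 0 \<Longrightarrow> br a b $ 1 = 0" "\<And>a b. b$1 = 0 \<Longrightarrow> br a b $ 1 = 0"
    and non_nilpotent: "\<exists>a b c d. br (br (br a b) c) d \<noteq> 0"
  obtains p r q where "algebra_isomorphic (*s) br UNIV (*s) (Rfam p r q) UNIV"
proof -
  interpret right_leibniz_algebra "(*s)" br by fact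
  define e n m c :: "complex ^ 4"
    where "e = vector [1, 0, 0, 0]" and "n = vector [0, 1, 0, 0]"
      and "m = vector [0, 0, 1, 0]" and "c = vector [0, 0, 0, 1]"
  have unit: "e$1 = 1" "e$2 = 0" "e$3 = 0" "e$4 = 0" "n$1 = 0" "n$2 = 1" "n$3 = 0" "n$4 = 0"
      "m$1 = 0" "m$2 = 0" "m$3 = 1" "m$4 = 0" "c$1 = 0" "c$2 = 0" "c$3 = 0" "c$4 = 1"
    by (simp_all add: e_def n_def m_def c_def)
  have expand: "a = a$1 *s e + a$2 *s n + a$3 *s m + a$4 *s c" for a
    by (simp add: vector_eq_iff_4 unit)
  have nn: "br n n = c" and nm: "br n m = 0" and mn: "br m n = 0" and mm: "br m m = 0"
    and cn: "br c n = 0" and cm: "br c m = 0"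
    by (simp_all add: mu1 vector_eq_iff_4 unit)
  have xc: "br a c = 0" for a
    using bracket_square_right[of a n] by (simp add: nn)
  \<comment> \<open>On the nilradical, bracketing with \<open>n\<close> reads off the
    \<open>n\<close>-coordinate; this is how the brackets below are shown to have none.\<close>
  have br_n: "br n a = a$2 *s c" "br a n = a$2 *s c" if "a$1 = 0" for a
    using mu1[of n a] mu1[of a n] that by (simp_all add: vector_eq_iff_4 unit)
  have c0: "k *s c = 0 \<longleftrightarrow> k = 0" for k
    by (simp add: vector_eq_iff_4 unit)
  have first: "br n e $ 1 = 0" "br e n $ 1 = 0" "br m e $ 1 = 0" "br e m $ 1 = 0"
    using ideal unit by simp_all
  have en2: "br e n $ 2 = 0"
    using dextral_symmetric_alternating(1)[OF dext, of n e] br_n(1)[of "br e n"] c0 first by simp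
  have ne2: "br n e $ 2 = 0"
    using dextral_symmetric_alternating(2)[OF dext, of n e] br_n(1)[of "br n e"] c0 first by simp
  have ce: "br c e = 0"
    using leibniz[of n n e] br_n[of "br n e"] ne2 first by (simp add: nn)
  have me2: "br m e $ 2 = 0"
    using leibniz[of m n e] br_n[of "br m e"] mu1[of m "br n e"] ne2 first c0
    by (simp add: mn unit vector_eq_iff_4)
  have em2: "br e m $ 2 = 0"
    using bracket_bracket_swap[of n e m] br_n[of "br e m"] br_n[of "br m e"] me2 first c0 by simp
  \<comment> \<open>Modulo the nilradical \<open>[e, e]\<close> is \<open>u$1\<close> times
    \<open>e\<close>, so \<open>[e, [e, e]] = 0\<close> becomes
    \<open>u$1 * u$1 = 0\<close>.\<close>
  have ee1: "br e e $ 1 = 0"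
  proof -
    define u where "u = br e e"
    have "br e u $ 1 = u$1 * u$1"
      by (subst expand[of u]) (simp add: bracket_add_right bracket_scale_right first ideal u_def unit)
    then show ?thesis
      using bracket_square_right[of e e] by (simp add: u_def)
  qed
  have ee2: "br e e $ 2 = 0"
    using bracket_square_right[of n e] br_n[of "br e e"] ee1 c0 by simp
  define f q b p b' p' \<beta> \<gamma> b'' g'' where "f = br e e $ 3" and "q = br e e $ 4"
    and "b = br n e $ 3" and "p = br n e $ 4" and "b' = br e n $ 3" and "p' = br e n $ 4"
    and "\<beta> = br m e $ 3" and "\<gamma> = br m e $ 4" and "b'' = br e m $ 3" and "g'' = br e m $ 4"
  have ee: "br e e = f *s m + q *s c" and ne: "br n e = b *s m + p *s c"
    and en: "br e n = b' *s m + p' *s c" and me: "br m e = \<beta> *s m + \<gamma> *s c"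
    and em: "br e m = b'' *s m + g'' *s c"
    using ee1 ee2 first en2 ne2 me2 em2
    by (simp_all add: vector_eq_iff_4 unit f_def q_def b_def p_def b'_def p'_def \<beta>_def \<gamma>_def
        b''_def g''_def)
  note table = ee ne en me em nn nm mn mm cn cm xc ce
  note bilinear = bracket_add_left bracket_add_right bracket_scale_left bracket_scale_right
  have br_eq: "br a d = vector [0, 0,
      f * a$1 * d$1 + b * a$2 * d$1 + b' * a$1 * d$2 + \<beta> * a$3 * d$1 + b'' * a$1 * d$3,
      q * a$1 * d$1 + p * a$2 * d$1 + p' * a$1 * d$2 + \<gamma> * a$3 * d$1 + g'' * a$1 * d$3
        + a$2 * d$2]" for a d
    by (subst expand[of a], subst expand[of d])
      (simp add: bilinear table vector_eq_iff_4 unit algebra_simps)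
  \<comment> \<open>Brackets lie in the span of \<open>m\<close> and \<open>c\<close>. If \<beta>
    were 0, one right multiplication would send them into the line of \<open>c\<close>, and a second
    one to 0.\<close>
  have \<beta>: "\<beta> \<noteq> 0"
    using non_nilpotent by (auto simp: br_eq vector_eq_iff_4)
  have "\<beta> *s br e m = 0"
    using dextral_symmetric_alternating(1)[OF dext, of e m]
    by (simp add: me bracket_add_right bracket_scale_right xc)
  with \<beta> have em0: "br e m = 0"
    by (simp add: vector_eq_iff_4)
  then have em0': "b'' = 0" "g'' = 0"
    by (simp_all add: b''_def g''_def)
  \<comment> \<open>In the Leibniz identity for \<open>e, e, n\<close> the other two terms vanish,
    and \<open>[[e, n], e]\<close> equals \<open>b'\<close> times \<open>[m, e]\<close>.\<close>
  have "br (br e n) e = 0"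
    using leibniz[of e e n] by (simp add: ee en bilinear em0 xc cn mn ce)
  with \<beta> have b': "b' = 0"
    by (auto simp: en me ce bilinear vector_eq_iff_4 unit)
  \<comment> \<open>\<open>h\<close> gives coordinates in the basis
    \<open>x = e / \<beta> - (f / \<beta>\<^sup>2) m\<close>,
    \<open>y = n - (b / \<beta>) z\<close>, \<open>z = m + (\<gamma> / \<beta>) c\<close>,
    \<open>w = c\<close>, chosen so that \<open>[z, x] = z\<close> and \<open>[x, x]\<close>,
    \<open>[y, x]\<close> lose their \<open>m\<close>-part; \<open>k\<close> is its inverse.\<close>
  define h :: "complex ^ 4 \<Rightarrow> complex ^ 4" where "h = (\<lambda>a. vector [\<beta> * a$1, a$2,
    a$3 + a$1 * f / \<beta> + a$2 * b / \<beta>, a$4 - \<gamma> / \<beta> * (a$3 + a$1 * f / \<beta>)])"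
  define k :: "complex ^ 4 \<Rightarrow> complex ^ 4" where "k = (\<lambda>a. vector [a$1 / \<beta>, a$2,
    a$3 - a$1 * f / \<beta>\<^sup>2 - a$2 * b / \<beta>, a$4 + \<gamma> / \<beta> * (a$3 - a$2 * b / \<beta>)])"
  have "bij h"
    by (rule o_bij[of k])
      (use \<beta> in \<open>auto simp: fun_eq_iff h_def k_def vector_eq_iff_4 field_simps power2_eq_square\<close>)
  moreover have "h (a + d) = h a + h d" "h (t *s a) = t *s h a" for a d t
    using \<beta> by (simp_all add: h_def vector_eq_iff_4 field_simps)
  moreover have "h (br a d) = Rfam (p' / \<beta>) ((p - b * \<gamma> / \<beta>) / \<beta>)
      ((q - f * \<gamma> / \<beta>) / \<beta>\<^sup>2) (h a) (h d)" for a d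
    unfolding br_eq em0' b' using \<beta>
    by (simp add: h_def Rfam_def vector_eq_iff_4 field_simps power2_eq_square)
  ultimately show ?thesis
    using that unfolding algebra_isomorphic_def by blast
qed


section \<open>Coordinates adapted to the nilradical\<close>

lemma right_leibniz_algebra_pullback:
  assumes "right_leibniz_algebra s\<^sub>2 b\<^sub>2" "vector_space s\<^sub>1" "inj g"
    and g: "\<And>u v. g (u + v) = g u + g v" "\<And>r u. g (s\<^sub>1 r u) = s\<^sub>2 r (g u)"
    "\<And>u v. g (b\<^sub>1 u v) = b\<^sub>2 (g u) (g v)"
  shows "right_leibniz_algebra s\<^sub>1 b\<^sub>1"
proof -
  interpret A: right_leibniz_algebra s\<^sub>2 b\<^sub>2 by fact
  interpret vector_space s\<^sub>1 by fact
  have "g (u - v) = g u - g v" for u v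
    using g(1)[of "u - v" v] by (simp add: algebra_simps)
  note g = g this
  show ?thesis
  proof
    show "b\<^sub>1 u (b\<^sub>1 v w) = b\<^sub>1 (b\<^sub>1 u v) w - b\<^sub>1 (b\<^sub>1 u w) v" for u v w
      by (rule injD[OF \<open>inj g\<close>]) (simp only: g A.leibniz)
  qed (rule injD[OF \<open>inj g\<close>], simp add: g A.bracket_add_left A.bracket_add_right
      A.bracket_scale_left A.bracket_scale_right)+
qed

lemma mu1_eq: "mu1 a b = vector [0, 0, a$1 * b$1]"
  by (simp add: mu1_def table_simps)

text \<open>Coordinate 1 is taken along a vector \<open>e\<close> outside \<open>N\<close>; the
  others come from the isomorphism with \<open>mu1\<close>. If all left-normed products of four
  elements vanished, the whole algebra would be a nilpotent ideal properly containing
  \<open>N\<close>.\<close>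

lemma nilradical_mu1_coordinates:
  fixes scale :: "complex \<Rightarrow> 'a::ab_group_add \<Rightarrow> 'a"
  assumes "right_leibniz_algebra scale br"
    and dim: "vector_space.dim scale (UNIV :: 'a set) = 4"
    and nil: "right_leibniz_algebra.is_nilradical scale br N"
    and iso: "algebra_isomorphic scale br N (*s) mu1 UNIV"
  obtains br' :: "complex ^ 4 \<Rightarrow> complex ^ 4 \<Rightarrow> complex ^ 4"
  where "algebra_isomorphic scale br UNIV (*s) br' UNIV"
    and "right_leibniz_algebra (*s) br'"
    and "\<And>a b. a$1 = 0 \<Longrightarrow> b$1 = 0 \<Longrightarrow> br' a b = vector [0, 0, 0, a$2 * b$2]"
    and "\<And>a b. a$1 = 0 \<Longrightarrow> br' a b $ 1 = 0" "\<And>a b. b$1 = 0 \<Longrightarrow> br' a b $ 1 = 0"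
    and "\<exists>a b c d. br' (br' (br' a b) c) d \<noteq> 0"
proof -
  interpret right_leibniz_algebra scale br by fact
  obtain B where "independent B" "span B = UNIV" "card B = 4"
    using basis_exists[of UNIV] dim by (metis top.extremum_uniqueI)
  \<comment> \<open>Infinite sets have \<open>card\<close> 0, so \<open>card B = 4\<close> makes the
    basis finite.\<close>
  then interpret fin: finite_dimensional_vector_space scale B
    by unfold_locales (auto intro: card_ge_0_finite)
  interpret from3: finite_dimensional_vector_space_pair_1
    "(*s) :: complex \<Rightarrow> complex ^ 3 \<Rightarrow> complex ^ 3" cart_basis scale ..
  interpret from4: finite_dimensional_vector_space_pair_1
    "(*s) :: complex \<Rightarrow> complex ^ 4 \<Rightarrow> complex ^ 4" cart_basis scale ..
  have N: "subspace N" "\<And>a b. a \<in> N \<Longrightarrow> br a b \<in> N" "\<And>a b. b \<in> N \<Longrightarrow> br a b \<in> N"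
    and maximal: "\<And>I. two_sided_ideal I \<Longrightarrow> nilpotent I \<Longrightarrow> N \<subseteq> I \<Longrightarrow> I = N"
    using nil unfolding is_nilradical_def two_sided_ideal_def by blast+
  have "algebra_isomorphic (*s) mu1 UNIV scale br N"
    using iso by (rule algebra_isomorphic_sym) (simp_all add: N subspace_add subspace_scale)
  then obtain h where h: "bij_betw h UNIV N" "\<And>u v. h (u + v) = h u + h v"
      "\<And>r u. h (r *s u) = scale r (h u)" "\<And>u v. h (mu1 u v) = br (h u) (h v)"
    unfolding algebra_isomorphic_def by blast
  have hN: "h u \<in> N" for u
    using h(1) bij_betwE by blast
  have "Vector_Spaces.linear (*s) scale h"
    by unfold_locales (simp_all add: h)
  then have "dim (range h) = 3"
    by (subst from3.dim_image_eq) (use h(1) in \<open>auto simp: bij_betw_def vec_dim_card simp del: vec.dim_UNIV\<close>)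
  then have "N \<noteq> UNIV"
    using h(1) dim by (auto simp: bij_betw_def)
  then obtain e where e: "e \<notin> N"
    by blast
  define g :: "complex ^ 4 \<Rightarrow> 'a"
    where "g = (\<lambda>a. scale (a$1) e + h (vector [a$2, a$3, a$4]))"
  have g_N: "g a \<in> N \<longleftrightarrow> a$1 = 0" for a
  proof
    assume "g a \<in> N"
    then have "scale (a$1) e \<in> N"
      using subspace_diff[OF N(1) _ hN, of "g a" "vector [a$2, a$3, a$4]"] by (simp add: g_def)
    then have "scale (inverse (a$1)) (scale (a$1) e) \<in> N"
      by (rule subspace_scale[OF N(1)])
    with e show "a$1 = 0"
      by (cases "a$1 = 0") auto
  qed (simp add: g_def hN)
  have g_add: "g (a + b) = g a + g b" for a b
  proof -
    have "vector [(a + b)$2, (a + b)$3, (a + b)$4] =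
        (vector [a$2, a$3, a$4] + vector [b$2, b$3, b$4] :: complex ^ 3)"
      by (simp add: vec_eq_iff forall_3)
    then show ?thesis
      by (simp add: g_def h scale_left_distrib)
  qed
  have g_scale: "g (r *s a) = scale r (g a)" for r a
  proof -
    have "vector [(r *s a)$2, (r *s a)$3, (r *s a)$4] =
        (r *s vector [a$2, a$3, a$4] :: complex ^ 3)"
      by (simp add: vec_eq_iff forall_3)
    then show ?thesis
      by (simp add: g_def h scale_right_distrib)
  qed
  have linear: "Vector_Spaces.linear (*s) scale g"
    by unfold_locales (simp_all add: g_add g_scale)
  have "a = 0" if "g a = 0" for a
  proof -
    have "a$1 = 0"
      using that g_N subspace_0[OF N(1)] by metis
    moreover have "h 0 = 0"
      using h(2)[of 0 0] by simp
    ultimately have "h (vector [a$2, a$3, a$4]) = h 0"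
      using that by (simp add: g_def)
    then have "vector [a$2, a$3, a$4] = (0 :: complex ^ 3)"
      using h(1) by (auto simp: bij_betw_def dest: injD)
    with \<open>a$1 = 0\<close> show ?thesis
      by (simp add: vec_eq_iff forall_3 forall_4)
  qed
  then have "inj g"
    using from4.linear_inj_iff_eq_0[OF linear] by blast
  have "dim (range g) = 4"
    by (subst from4.dim_image_eq) (use linear \<open>inj g\<close> in \<open>auto simp: vec_dim_card simp del: vec.dim_UNIV\<close>)
  then have "range g = UNIV"
    using from4.linear_subspace_image[OF linear vec.subspace_UNIV] dim
    by (intro fin.subspace_dim_equal) auto
  with \<open>inj g\<close> have "bij g"
    by (simp add: bij_def)
  define br' where "br' = (\<lambda>a b. inv g (br (g a) (g b)))"
  have g_br: "g (br' a b) = br (g a) (g b)" for a b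
    using \<open>bij g\<close> by (simp add: br'_def bij_is_surj surj_f_inv_f)
  show ?thesis
  proof
    have "algebra_isomorphic (*s) br' UNIV scale br UNIV"
      unfolding algebra_isomorphic_def using \<open>bij g\<close> g_add g_scale g_br by blast
    then show "algebra_isomorphic scale br UNIV (*s) br' UNIV"
      by (rule algebra_isomorphic_sym) simp_all
    show "right_leibniz_algebra (*s) br'"
      by (rule right_leibniz_algebra_pullback[where g = g and s\<^sub>2 = scale and b\<^sub>2 = br])
        (fact right_leibniz_algebra_axioms vec.vector_space_axioms \<open>inj g\<close> g_add g_scale g_br)+
    show "br' a b $ 1 = 0" if "a$1 = 0" for a b
      using that N(2)[of "g a" "g b"] by (simp flip: g_N add: g_br)
    show "br' a b $ 1 = 0" if "b$1 = 0" for a b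
      using that N(3)[of "g b" "g a"] by (simp flip: g_N add: g_br)
    show "br' a b = vector [0, 0, 0, a$2 * b$2]" if "a$1 = 0" "b$1 = 0" for a b
    proof (rule injD[OF \<open>inj g\<close>])
      have "g (br' a b) = h (mu1 (vector [a$2, a$3, a$4]) (vector [b$2, b$3, b$4]))"
        using that by (simp only: g_br h(4)) (simp add: g_def)
      then show "g (br' a b) = g (vector [0, 0, 0, a$2 * b$2])"
        by (simp add: mu1_eq) (simp add: g_def)
    qed
    show "\<exists>a b c d. br' (br' (br' a b) c) d \<noteq> 0"
    proof (rule ccontr)
      assume *: "\<not> ?thesis"
      \<comment> \<open>The instance \<open>g_scale[of 0 0]\<close> supplies
        \<open>g 0 = 0\<close>.\<close>
      have "br (br (br (g a) (g b)) (g c)) (g d) = 0" for a b c d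
        using * g_scale[of 0 0] by (simp flip: g_br)
      then have "br (br (br a b) c) d = 0" for a b c d
        using bij_is_surj[OF \<open>bij g\<close>] by (metis surjD)
      then have "nilpotent UNIV"
        by (rule nilpotent_UNIV)
      moreover have "two_sided_ideal UNIV"
        by (simp add: two_sided_ideal_def)
      ultimately show False
        using maximal \<open>N \<noteq> UNIV\<close> by blast
    qed
  qed
qed

theorem proposition5p9:
  fixes scale :: "complex \<Rightarrow> 'a::ab_group_add \<Rightarrow> 'a"
    and br :: "'a \<Rightarrow> 'a \<Rightarrow> 'a"
    and N :: "'a set"
  assumes "right_leibniz_algebra scale br"
    and "vector_space.dim scale (UNIV :: 'a set) = 4"
    and "right_leibniz_algebra.solvable scale br"
    and "right_leibniz_algebra.is_nilradical scale br N"
    and "algebra_isomorphic scale br N (*s) mu1 UNIV"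
  shows "(right_leibniz_algebra.dextral_symmetric br \<longleftrightarrow>
      (\<exists>\<beta>. algebra_isomorphic scale br UNIV (*s) (R3 \<beta>) UNIV) \<or>
      algebra_isomorphic scale br UNIV (*s) R4 UNIV \<or>
      algebra_isomorphic scale br UNIV (*s) R5 UNIV) \<and>
    (\<forall>\<beta> \<gamma>. \<beta> \<noteq> \<gamma> \<longrightarrow> \<not> algebra_isomorphic (*s) (R3 \<beta>) UNIV (*s) (R3 \<gamma>) UNIV) \<and>
    (\<forall>\<beta>. \<not> algebra_isomorphic (*s) (R3 \<beta>) UNIV (*s) R4 UNIV) \<and>
    (\<forall>\<beta>. \<not> algebra_isomorphic (*s) (R3 \<beta>) UNIV (*s) R5 UNIV) \<and>
    \<not> algebra_isomorphic (*s) R4 UNIV (*s) R5 UNIV"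
proof (intro conjI allI impI iffI)
  assume dext: "right_leibniz_algebra.dextral_symmetric br"
  show "(\<exists>\<beta>. algebra_isomorphic scale br UNIV (*s) (R3 \<beta>) UNIV) \<or>
      algebra_isomorphic scale br UNIV (*s) R4 UNIV \<or>
      algebra_isomorphic scale br UNIV (*s) R5 UNIV"
  proof (rule nilradical_mu1_coordinates[OF assms(1,2,4,5)])
    fix br' :: "complex ^ 4 \<Rightarrow> complex ^ 4 \<Rightarrow> complex ^ 4"
    assume br': "algebra_isomorphic scale br UNIV (*s) br' UNIV" "right_leibniz_algebra (*s) br'"
      "\<And>a b. a$1 = 0 \<Longrightarrow> b$1 = 0 \<Longrightarrow> br' a b = vector [0, 0, 0, a$2 * b$2]"
      "\<And>a b. a$1 = 0 \<Longrightarrow> br' a b $ 1 = 0" "\<And>a b. b$1 = 0 \<Longrightarrow> br' a b $ 1 = 0"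
      "\<exists>a b c d. br' (br' (br' a b) c) d \<noteq> 0"
    have "algebra_isomorphic (*s) br' UNIV scale br UNIV"
      using br'(1) by (rule algebra_isomorphic_sym) simp_all
    then have "right_leibniz_algebra.dextral_symmetric br'"
      using dextral_symmetric_transfer br'(2) assms(1) dext by blast
    then obtain p r q where "algebra_isomorphic (*s) br' UNIV (*s) (Rfam p r q) UNIV"
      by (rule algebra_isomorphic_Rfam[OF br'(2) _ br'(3-6)])
    with br'(1) have "algebra_isomorphic scale br UNIV (*s) (Rfam p r q) UNIV"
      by (rule algebra_isomorphic_trans)
    then show ?thesis
      using Rfam_isomorphic_normal_form[of p r q] algebra_isomorphic_trans by blast
  qed
next
  assume "(\<exists>\<beta>. algebra_isomorphic scale br UNIV (*s) (R3 \<beta>) UNIV) \<or>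
      algebra_isomorphic scale br UNIV (*s) R4 UNIV \<or>
      algebra_isomorphic scale br UNIV (*s) R5 UNIV"
  then obtain p r q where "algebra_isomorphic scale br UNIV (*s) (Rfam p r q) UNIV"
    unfolding R3_eq_Rfam R4_eq_Rfam R5_eq_Rfam by blast
  then show "right_leibniz_algebra.dextral_symmetric br"
    by (rule dextral_symmetric_transfer[OF assms(1) right_leibniz_algebra_Rfam _
          dextral_symmetric_Rfam])
\<comment> \<open>The antisymmetric part \<open>p - r\<close> is 1 for \<open>R3 \<beta>\<close> and
  0 for \<open>R4\<close> and \<open>R5\<close>. Between two algebras \<open>R3\<close> it forces
  \<open>s = 1\<close>, and \<open>4 * \<beta> - 1\<close> is then invariant; \<open>R4\<close> and
  \<open>R5\<close> have \<open>4 * q - (p + r)\<^sup>2\<close> equal to 0 and -4.\<close>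
qed (auto simp: R3_eq_Rfam R4_eq_Rfam R5_eq_Rfam elim!: Rfam_isomorphic_imp)

end
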